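(* Every subcubic graph $G$ with $\mathrm{mad}(G) < \frac{20}{9}$ has a $(1^2,2^2)$-packing edge-coloring.
   Context: Graphs are simple. A graph is subcubic if its maximum degree is at most $3$. The maximum average degree is $\mathrm{mad}(G)=\max\{2|E(H)|/|V(H)| : H\subseteq G\}$. The distance between two edges is the distance between the corresponding vertices in the line graph. A $(1^2,2^2)$-packing edge-coloring of $G$ is a partition of $E(G)$ into two matchings and two induced matchings, i.e. sets $E_1,E_2,E_3,E_4$ such that distinct edges in the same $E_i$ are at distance at least $2$ for $i\in\{1,2\}$ and at distance at least $3$ for $i\in\{3,4\}$. *)

theory Defs
  imports Main "HOL.Real"
begin

definition graph :: "'a set \<Rightarrow> 'a set set \<Rightarrow> bool" where
  "graph V E \<longleftrightarrow> finite V \<and> (\<forall>e\<in>E. \<exists>u v. e = {u, v} \<and> u \<noteq> v \<and> u \<in> V \<and> v \<in> V)"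

definition degree :: "'a set set \<Rightarrow> 'a \<Rightarrow> nat" where
  "degree E v = card {e \<in> E. v \<in> e}"

definition subcubic :: "'a set \<Rightarrow> 'a set set \<Rightarrow> bool" where
  "subcubic V E \<longleftrightarrow> (\<forall>v\<in>V. degree E v \<le> 3)"

definition subgraph :: "'a set \<Rightarrow> 'a set set \<Rightarrow> 'a set \<Rightarrow> 'a set set \<Rightarrow> bool" where
  "subgraph V' E' V E \<longleftrightarrow> V' \<subseteq> V \<and> E' \<subseteq> E \<and> graph V' E'"

definition mad :: "'a set \<Rightarrow> 'a set set \<Rightarrow> real" where
  "mad V E = Max {2 * real (card E') / real (card V') | V' E'. subgraph V' E' V E \<and> V' \<noteq> {}}"

definition line_adj :: "'a set \<Rightarrow> 'a set \<Rightarrow> bool" where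
  "line_adj e f \<longleftrightarrow> e \<noteq> f \<and> e \<inter> f \<noteq> {}"

definition edge_walk :: "'a set set \<Rightarrow> 'a set \<Rightarrow> 'a set \<Rightarrow> nat \<Rightarrow> bool" where
  "edge_walk E e f n \<longleftrightarrow> (\<exists>ps. length ps = Suc n \<and> hd ps = e \<and> last ps = f \<and> set ps \<subseteq> E \<and>
      (\<forall>i<n. line_adj (ps ! i) (ps ! Suc i)))"

definition edge_dist_ge :: "'a set set \<Rightarrow> nat \<Rightarrow> 'a set \<Rightarrow> 'a set \<Rightarrow> bool" where
  "edge_dist_ge E d e f \<longleftrightarrow> \<not> (\<exists>n<d. edge_walk E e f n)"

definition dist_packing :: "'a set set \<Rightarrow> nat \<Rightarrow> 'a set set \<Rightarrow> bool" where
  "dist_packing E d M \<longleftrightarrow> M \<subseteq> E \<and> (\<forall>e\<in>M. \<forall>f\<in>M. e \<noteq> f \<longrightarrow> edge_dist_ge E d e f)"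

definition packing_1122 :: "'a set set \<Rightarrow> bool" where
  "packing_1122 E \<longleftrightarrow> (\<exists>E1 E2 E3 E4.
     E1 \<union> E2 \<union> E3 \<union> E4 = E \<and>
     E1 \<inter> E2 = {} \<and> E1 \<inter> E3 = {} \<and> E1 \<inter> E4 = {} \<and>
     E2 \<inter> E3 = {} \<and> E2 \<inter> E4 = {} \<and> E3 \<inter> E4 = {} \<and>
     dist_packing E 2 E1 \<and> dist_packing E 2 E2 \<and>
     dist_packing E 3 E3 \<and> dist_packing E 3 E4)"

end

theory Submission
  imports Defs
begin

text \<open>
  Colour the vertices with two colours so that every vertex has at most one neighbour of its own
  colour and at most two of the other colour. The monochromatic edges of each colour then form an
  induced matching, and the bichromatic edges form a bipartite graph of maximum degree at most 2,
  hence a union of two matchings.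

  In a vertex-minimal graph without such a colouring all degrees are 2 or 3, no four consecutive
  vertices have degree 2, and no 3-vertex has three incident threads of lengths at least 3, 3 and 2.
  So the threads at a 3-vertex contain at most 7 vertices in total. Every 2-vertex is counted
  from both ends of its thread, so there are at most 7/2 times as many 2-vertices as 3-vertices, and
  the average degree is at least 20/9.
\<close>

section \<open>Balanced vertex two-colourings\<close>

text \<open>The vertex set is a separate argument, so that passing to an induced subgraph only
  shrinks \<open>X\<close> while the relation \<open>R\<close> stays fixed.\<close>

definition nbs :: "('a \<Rightarrow> 'a \<Rightarrow> bool) \<Rightarrow> 'a set \<Rightarrow> 'a \<Rightarrow> 'a set" where
  "nbs R X v = {w \<in> X. R v w}"

definition balanced_at :: "'a set \<Rightarrow> ('a \<Rightarrow> bool) \<Rightarrow> 'a \<Rightarrow> bool" where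
  "balanced_at N m v \<longleftrightarrow> card {w \<in> N. m w = m v} \<le> 1 \<and> card {w \<in> N. m w \<noteq> m v} \<le> 2"

definition balanced :: "('a \<Rightarrow> 'a \<Rightarrow> bool) \<Rightarrow> 'a set \<Rightarrow> ('a \<Rightarrow> bool) \<Rightarrow> bool" where
  "balanced R X m \<longleftrightarrow> (\<forall>v\<in>X. balanced_at (nbs R X v) m v)"

lemma balanced_at_subset:
  assumes "{w \<in> N. m w = m v} \<subseteq> {r}" "{w \<in> N. m w \<noteq> m v} \<subseteq> {p, q}"
  shows "balanced_at N m v"
proof -
  have "card {w \<in> N. m w = m v} \<le> card {r}" "card {w \<in> N. m w \<noteq> m v} \<le> card {p, q}"
    using assms by (meson card_mono finite.emptyI finite.insertI)+
  moreover have "card {p, q} \<le> 2" by (simp add: card_insert_if)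
  ultimately show ?thesis unfolding balanced_at_def by simp
qed

text \<open>A 2-vertex can only fail by having both neighbours in its own colour. In the reductions
  below it is therefore enough to give each affected 2-vertex one neighbour of the other
  colour.\<close>

lemma balanced_at_two:
  assumes "N = {p, q}" "m p \<noteq> m v \<or> m q \<noteq> m v"
  shows "balanced_at N m v"
  using assms balanced_at_subset[of N m v q p q] balanced_at_subset[of N m v p p q] by blast

lemma balanced_at_three:
  assumes "N = {p, q, r}" "m p \<noteq> m v" "m q \<noteq> m v" "m r = m v"
  shows "balanced_at N m v"
  by (rule balanced_at_subset[of N m v r p q]) (use assms in auto)

lemma balanced_at_cong:
  assumes "\<And>w. w \<in> N \<Longrightarrow> m w = m' w" "m v = m' v"
  shows "balanced_at N m v \<longleftrightarrow> balanced_at N m' v"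
proof -
  have "{w \<in> N. m w = m v} = {w \<in> N. m' w = m' v}" "{w \<in> N. m w \<noteq> m v} = {w \<in> N. m' w \<noteq> m' v}"
    using assms by auto
  then show ?thesis unfolding balanced_at_def by metis
qed

text \<open>Outside \<open>D\<close> nothing is recoloured, and a vertex without neighbours in
  \<open>D\<close> has the same neighbourhood before and after the deletion. Each reduction thus has
  to check only \<open>D\<close> and the neighbours of \<open>D\<close>.\<close>

lemma balanced_unchanged:
  assumes bal: "balanced R (X - D) m" and u: "u \<in> X" "u \<notin> D"
    and nadj: "\<And>d. d \<in> D \<Longrightarrow> \<not> R u d" and eq: "\<And>w. w \<notin> D \<Longrightarrow> m' w = m w"
  shows "balanced_at (nbs R X u) m' u"
proof -
  have N: "nbs R X u = nbs R (X - D) u" using nadj unfolding nbs_def by auto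
  have "balanced_at (nbs R (X - D) u) m u" using bal u unfolding balanced_def by auto
  then show ?thesis
    unfolding N by (subst balanced_at_cong[where m' = m]) (use eq u in \<open>auto simp: nbs_def\<close>)
qed

section \<open>Reducible configurations in a minimal counterexample\<close>

text \<open>Minimality ranges over induced subgraphs, since every reduction deletes vertices,
  colours the rest and extends that colouring.\<close>

locale critical =
  fixes R :: "'a \<Rightarrow> 'a \<Rightarrow> bool" and X :: "'a set"
  assumes sym: "R u v \<Longrightarrow> R v u" and irrefl: "\<not> R u u" and fin: "finite X"
    and deg_le_3: "v \<in> X \<Longrightarrow> card (nbs R X v) \<le> 3"
    and not_balanced: "\<not> balanced R X m"
    and smaller: "Y \<subset> X \<Longrightarrow> \<exists>m. balanced R Y m"
begin

abbreviation N :: "'a \<Rightarrow> 'a set" where "N \<equiv> nbs R X"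

lemma finite_N: "finite (N v)"
  using fin unfolding nbs_def by auto

lemma N_sym: "u \<in> X \<Longrightarrow> v \<in> N u \<Longrightarrow> u \<in> N v"
  unfolding nbs_def using sym by auto

lemma N_in: "v \<in> N u \<Longrightarrow> v \<in> X"
  unfolding nbs_def by auto

lemma N_irrefl: "u \<notin> N u"
  unfolding nbs_def using irrefl by auto

lemma N_other:
  assumes "card (N u) = 2" "w \<in> N u"
  shows "\<exists>a. N u = {w, a} \<and> a \<noteq> w"
  using assms by (auto simp: card_2_iff)

text \<open>An isolated vertex may take any colour. A leaf can be coloured last because its
  neighbour \<open>u\<close> has at most two other neighbours.\<close>

lemma deg_ge_2:
  assumes v: "v \<in> X"
  shows "2 \<le> card (N v)"
proof (rule ccontr)
  assume "\<not> 2 \<le> card (N v)"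
  then consider "card (N v) = 0" | "card (N v) = 1" by linarith
  then show False
  proof cases
    case 1
    then have Nv: "N v = {}" using finite_N by auto
    obtain m where m: "balanced R (X - {v}) m" using smaller[of "X - {v}"] v by auto
    have "balanced_at (N u) m u" if u: "u \<in> X" for u
    proof (cases "u = v")
      case True
      then show ?thesis by (simp add: Nv balanced_at_def)
    next
      case False
      have "\<not> R u v" using Nv N_sym[of u v] u v unfolding nbs_def by auto
      then show ?thesis using balanced_unchanged[OF m u, of m] False by auto
    qed
    then show False using not_balanced unfolding balanced_def by blast
  next
    case 2
    then obtain u where Nv: "N v = {u}" by (auto simp: card_1_singleton_iff)
    then have uX: "u \<in> X" and uv: "u \<noteq> v" using N_in N_irrefl by auto
    obtain m where m: "balanced R (X - {v}) m" using smaller[of "X - {v}"] v by auto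
    let ?N = "nbs R (X - {v}) u"
    have Nu: "N u = insert v ?N" "v \<notin> ?N" using Nv v N_sym[of v u] unfolding nbs_def by auto
    have finN: "finite ?N" using finite_N[of u] Nu by auto
    have "card ?N \<le> 2" using deg_le_3[OF uX] Nu finN by simp
    let ?s = "{w \<in> ?N. m w = m u}" and ?o = "{w \<in> ?N. m w \<noteq> m u}"
    have "card ?N = card ?s + card ?o"
      by (subst card_Un_disjoint[symmetric]) (use finN in \<open>auto intro!: arg_cong[where f = card]\<close>)
    then have so: "card ?s + card ?o \<le> 2" using \<open>card ?N \<le> 2\<close> by simp
    have s1: "card ?s \<le> 1" using m uX uv unfolding balanced_def balanced_at_def by auto
    \<comment> \<open>If \<open>u\<close> has no neighbour of its own colour yet, \<open>v\<close>
      becomes the one it may have. Otherwise \<open>u\<close> has exactly one, hence at most one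
      neighbour of the other colour, and \<open>v\<close> can be the second.\<close>
    define m' where "m' = m(v := (if ?s = {} then m u else \<not> m u))"
    have m'u: "m' u = m u" using uv by (simp add: m'_def)
    have atu: "balanced_at (N u) m' u"
    proof (cases "?s = {}")
      case True
      have "{w \<in> N u. m' w = m' u} = {v}" "{w \<in> N u. m' w \<noteq> m' u} = ?o"
        using True Nu m'u uv by (auto simp: m'_def split: if_splits)
      then show ?thesis unfolding balanced_at_def using so by simp
    next
      case False
      then have "card ?s = 1" using s1 finN card_gt_0_iff[of ?s] by fastforce
      have "{w \<in> N u. m' w = m' u} = ?s" "{w \<in> N u. m' w \<noteq> m' u} = insert v ?o"
        using False Nu m'u uv by (auto simp: m'_def split: if_splits)
      moreover have "card (insert v ?o) \<le> 2"
        using so \<open>card ?s = 1\<close> finN by (simp add: card_insert_if)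
      ultimately show ?thesis unfolding balanced_at_def using s1 by simp
    qed
    have "balanced_at (N w) m' w" if w: "w \<in> X" for w
    proof -
      consider "w = v" | "w = u" | "w \<noteq> v" "w \<noteq> u" by blast
      then show ?thesis
      proof cases
        case 1
        have "{z \<in> N v. m' z = m' v} \<subseteq> {u}" "{z \<in> N v. m' z \<noteq> m' v} \<subseteq> {u}" using Nv by auto
        then have "card {z \<in> N v. m' z = m' v} \<le> card {u}" "card {z \<in> N v. m' z \<noteq> m' v} \<le> card {u}"
          by (meson card_mono finite.emptyI finite.insertI)+
        then show ?thesis unfolding 1 balanced_at_def by simp
      next
        case 2
        then show ?thesis using atu by simp
      next
        case 3
        have "\<not> R w v" using N_sym[of w v] Nv w v 3 unfolding nbs_def by auto
        then show ?thesis using balanced_unchanged[OF m w, of m'] 3 by (auto simp: m'_def)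
      qed
    qed
    then show False using not_balanced unfolding balanced_def by blast
  qed
qed

text \<open>Delete the middle pair of the path \<open>a\<close>, \<open>p\<close>, \<open>q\<close>,
  \<open>b\<close>, then colour \<open>p\<close> against \<open>a\<close> and \<open>q\<close>
  against \<open>b\<close>: each of the four 2-vertices gets a neighbour of the other colour. The
  case \<open>a = b\<close>, a triangle component, is included.\<close>

lemma no_four_thread:
  assumes p: "p \<in> X" and q: "q \<in> X" and Np: "N p = {a, q}" and Nq: "N q = {p, b}"
    and ne: "a \<noteq> q" "b \<noteq> p" and a: "card (N a) = 2" and b: "card (N b) = 2"
  shows False
proof -
  have "a \<in> N p" "b \<in> N q" using Np Nq by auto
  then have X: "a \<in> X" "b \<in> X" using N_in by blast+
  have pN: "p \<in> N a" "q \<in> N b" using N_sym p q Np Nq by auto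
  obtain a' where Na: "N a = {p, a'}" using N_other[OF a pN(1)] by blast
  obtain b' where Nb: "N b = {q, b'}" using N_other[OF b pN(2)] by blast
  have ap: "a \<noteq> p" "b \<noteq> q" using N_irrefl Np Nq by auto
  have pq: "p \<noteq> q" using N_irrefl Np by auto
  obtain m where m: "balanced R (X - {p, q}) m" using smaller[of "X - {p, q}"] p by auto
  define m' where "m' = m(p := \<not> m a, q := \<not> m b)"
  have mm: "m' a = m a" "m' b = m b" "m' p \<noteq> m a" "m' q \<noteq> m b"
    using ne ap pq by (auto simp: m'_def)
  have "balanced_at (N w) m' w" if w: "w \<in> X" for w
  proof -
    consider "w = p" | "w = q" | "w = a" | "w = b" | "w \<notin> {a, b, p, q}" by blast
    then show ?thesis
    proof cases
      case 1 then show ?thesis using balanced_at_two[OF Np, of m' p] mm by auto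
    next
      case 2 then show ?thesis using balanced_at_two[OF Nq, of m' q] mm by auto
    next
      case 3 then show ?thesis using balanced_at_two[OF Na, of m' a] mm by auto
    next
      case 4 then show ?thesis using balanced_at_two[OF Nb, of m' b] mm by auto
    next
      case 5
      then have "w \<notin> N p" "w \<notin> N q" using Np Nq by auto
      then have "\<not> R w p" "\<not> R w q" using w sym unfolding nbs_def by auto
      then show ?thesis using balanced_unchanged[OF m w, of m'] 5 by (auto simp: m'_def)
    qed
  qed
  then show False using not_balanced unfolding balanced_def by blast
qed

text \<open>Delete \<open>v\<close>, \<open>x1\<close>, \<open>x2\<close>, \<open>y1\<close>,
  \<open>y2\<close>, \<open>z1\<close>. Let \<open>v\<close> and \<open>z1\<close> share a colour
  that \<open>z2\<close> does not get, give \<open>x1\<close> and \<open>y1\<close> the other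
  colour, and colour \<open>x2\<close> against \<open>x3\<close> and \<open>y2\<close> against
  \<open>y3\<close>. Then \<open>v\<close> has one neighbour of its own colour and two of the other,
  and every 2-vertex involved has a neighbour of the other colour. The rest of the work concerns
  coincidences between the three threads.\<close>

lemma no_332_vertex:
  assumes v: "v \<in> X" and Nv: "N v = {x1, y1, z1}"
    and distinct: "x1 \<noteq> y1" "x1 \<noteq> z1" "y1 \<noteq> z1"
    and Nx1: "N x1 = {v, x2}" "x2 \<noteq> v" and Nx2: "N x2 = {x1, x3}" "x3 \<noteq> x1" and x3: "card (N x3) = 2"
    and Ny1: "N y1 = {v, y2}" "y2 \<noteq> v" and Ny2: "N y2 = {y1, y3}" "y3 \<noteq> y1" and y3: "card (N y3) = 2"
    and Nz1: "N z1 = {v, z2}" "z2 \<noteq> v" and z2: "card (N z2) = 2"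
  shows False
proof -
  have dv: "card (N v) = 3" using Nv distinct by simp
  have X: "x1 \<in> X" "y1 \<in> X" "z1 \<in> X" using Nv N_in by auto
  have nxt: "x2 \<in> N x1" "y2 \<in> N y1" "z2 \<in> N z1" "x3 \<in> N x2" "y3 \<in> N y2"
    using Nx1 Ny1 Nz1 Nx2 Ny2 by auto
  have X2: "x2 \<in> X" "y2 \<in> X" "z2 \<in> X" using nxt N_in by blast+
  have X3: "x3 \<in> X" "y3 \<in> X" using nxt N_in by blast+
  have "x2 \<in> N x3" "y2 \<in> N y3" "z1 \<in> N z2" using N_sym X X2 nxt by blast+
  obtain x4 where Nx3: "N x3 = {x2, x4}" "x4 \<noteq> x2"
    using N_other[OF x3 \<open>x2 \<in> N x3\<close>] by blast
  obtain y4 where Ny3: "N y3 = {y2, y4}" "y4 \<noteq> y2"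
    using N_other[OF y3 \<open>y2 \<in> N y3\<close>] by blast
  obtain z3 where Nz2: "N z2 = {z1, z3}" "z3 \<noteq> z1"
    using N_other[OF z2 \<open>z1 \<in> N z2\<close>] by blast
  have d2: "card (N x1) = 2" "card (N x2) = 2" "card (N y1) = 2" "card (N y2) = 2" "card (N z1) = 2"
    using Nx1 Nx2 Ny1 Ny2 Nz1 by auto
  have vne: "v \<noteq> x1" "v \<noteq> x2" "v \<noteq> x3" "v \<noteq> y1" "v \<noteq> y2" "v \<noteq> y3" "v \<noteq> z1" "v \<noteq> z2"
    using dv d2 x3 y3 z2 by auto
  have nv: "v \<notin> N x2" "v \<notin> N y2" using Nx2 Ny2 vne by auto
  have ne: "x2 \<notin> {x1, y1, z1}" "y2 \<notin> {x1, y1, z1}"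
    using nv Nx1 Ny1 Nz1 by auto
  have irr: "x3 \<noteq> x2" "y3 \<noteq> y2" "z2 \<noteq> z1" using Nx2 Ny2 Nz1 N_irrefl by blast+
  \<comment> \<open>Otherwise the threads through \<open>x1\<close> and \<open>y1\<close> are one
    thread, on which \<open>x1\<close>, \<open>x2\<close>, \<open>x3\<close>, \<open>x4\<close> are
    four consecutive 2-vertices.\<close>
  have x3y2: "x3 \<noteq> y2"
  proof
    assume eq: "x3 = y2"
    have "card (N x4) = 2" using Nx3 Ny2 eq d2 y3 by (metis doubleton_eq_iff)
    then show False using no_four_thread[OF X2(1) X3(1) Nx2(1) Nx3(1)] Nx2 Nx3 d2 by auto
  qed
  have y3x2: "y3 \<noteq> x2"
  proof
    assume eq: "y3 = x2"
    have "card (N y4) = 2" using Ny3 Nx2 eq d2 x3 by (metis doubleton_eq_iff)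
    then show False using no_four_thread[OF X2(2) X3(2) Ny2(1) Ny3(1)] Ny2 Ny3 d2 by auto
  qed
  have z2ne: "z2 \<noteq> x1" "z2 \<noteq> y1"
    using \<open>z1 \<in> N z2\<close> Nx1 Ny1 ne vne by auto
  have loopx: "x3 = z1" if "z2 = x2" using \<open>z1 \<in> N z2\<close> that Nx2 distinct by auto
  have loopy: "y3 = z1" if "z2 = y2" using \<open>z1 \<in> N z2\<close> that Ny2 distinct by auto
  \<comment> \<open>The case \<open>x2 = y2\<close> may occur. Then \<open>x3\<close> and
    \<open>y3\<close> are \<open>y1\<close> and \<open>x1\<close>, which receive equal colours, so
    the two updates of this vertex in \<open>m'\<close> agree.\<close>
  have loop: "x3 = y1" "y3 = x1" if "x2 = y2" using Nx2 Ny2 that distinct by (auto simp: doubleton_eq_iff)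

  let ?D = "{v, x1, x2, y1, y2, z1}"
  obtain m where m: "balanced R (X - ?D) m" using smaller[of "X - ?D"] v by auto
  \<comment> \<open>If the thread through \<open>z1\<close> closes up to that of \<open>x1\<close> or \<open>y1\<close>, then \<open>z2\<close> is deleted as well and \<open>c\<close> is arbitrary.\<close>
  define c where "c = (\<not> m z2)"
  define k where "k = m(v := c, z1 := c, x1 := \<not> c, y1 := \<not> c)"
  \<comment> \<open>\<open>x2\<close> and \<open>y2\<close> come last because \<open>x3\<close> may
    be \<open>y1\<close> or \<open>z1\<close>, and \<open>y3\<close> may be \<open>x1\<close> or
    \<open>z1\<close>: the colours to oppose are the new ones in \<open>k\<close>.\<close>
  define m' where "m' = k(x2 := \<not> k x3, y2 := \<not> k y3)"
  have kk: "k v = c" "k z1 = c" "k x1 = (\<not> c)" "k y1 = (\<not> c)"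
    using vne distinct by (auto simp: k_def)
  have mv: "m' v = c" "m' z1 = c" "m' x1 = (\<not> c)" "m' y1 = (\<not> c)"
    using kk ne vne by (auto simp: m'_def)
  have mx: "m' x2 = (\<not> k x3)" "m' y2 = (\<not> k y3)" using loop kk by (auto simp: m'_def)
  have mx3: "m' x2 \<noteq> m' x3" "m' y2 \<noteq> m' y3"
    using mx irr x3y2 y3x2 by (auto simp: m'_def)
  have mz: "m' z2 \<noteq> c"
  proof -
    consider "z2 = x2" | "z2 = y2" | "z2 \<noteq> x2" "z2 \<noteq> y2" by blast
    then show ?thesis
    proof cases
      case 1 then show ?thesis using mx loopx kk by auto
    next
      case 2 then show ?thesis using mx loopy kk by auto
    next
      case 3
      then have "m' z2 = m z2" using z2ne vne irr by (auto simp: m'_def k_def)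
      then show ?thesis by (simp add: c_def)
    qed
  qed
  have "balanced_at (N w) m' w" if w: "w \<in> X" for w
  proof -
    consider "w = v" | "w = x1" | "w = y1" | "w = x2" | "w = y2" | "w = z1" | "w = x3" | "w = y3" | "w = z2"
      | "w \<notin> ?D" "w \<notin> {x3, y3, z2}" by blast
    then show ?thesis
    proof cases
      case 1 then show ?thesis using balanced_at_three[OF Nv, of m' v] mv by auto
    next
      case 2 then show ?thesis using balanced_at_two[OF Nx1(1), of m' x1] mv by auto
    next
      case 3 then show ?thesis using balanced_at_two[OF Ny1(1), of m' y1] mv by auto
    next
      case 4 then show ?thesis using balanced_at_two[OF Nx2(1), of m' x2] mx3 by auto
    next
      case 5 then show ?thesis using balanced_at_two[OF Ny2(1), of m' y2] mx3 by auto
    next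
      case 6 then show ?thesis using balanced_at_two[OF Nz1(1), of m' z1] mz mv by auto
    next
      case 7 then show ?thesis using balanced_at_two[OF Nx3(1), of m' x3] mx3 by auto
    next
      case 8 then show ?thesis using balanced_at_two[OF Ny3(1), of m' y3] mx3 by auto
    next
      case 9 then show ?thesis using balanced_at_two[OF Nz2(1), of m' z2] mv mz by auto
    next
      case 10
      then have "w \<notin> N d" if "d \<in> ?D" for d
        using that Nv Nx1 Nx2 Ny1 Ny2 Nz1 by auto
      then have "\<not> R w d" if "d \<in> ?D" for d using that w sym unfolding nbs_def by blast
      then show ?thesis using balanced_unchanged[OF m w, of m'] 10 by (auto simp: m'_def k_def)
    qed
  qed
  then show False using not_balanced unfolding balanced_def by blast
qed

section \<open>Threads at 3-vertices and the count of 2-vertices\<close>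

text \<open>
  A 2-vertex \<open>w\<close> is recorded together with its predecessor \<open>p\<close> on the thread, since both ends of a
  thread may lie at the same 3-vertex; only the first three vertices after \<open>v\<close> matter.
\<close>

definition thread :: "'a \<Rightarrow> 'a \<Rightarrow> ('a \<times> 'a) set" where
  "thread v x = {(w, p). card (N w) = 2 \<and>
     (w = x \<and> p = v \<or>
      card (N x) = 2 \<and> p = x \<and> w \<in> N x - {v} \<or>
      card (N x) = 2 \<and> p \<in> N x - {v} \<and> card (N p) = 2 \<and> w \<in> N p - {x})}"

definition long2 :: "'a \<Rightarrow> 'a \<Rightarrow> bool" where
  "long2 v x \<longleftrightarrow> (\<exists>x2. N x = {v, x2} \<and> x2 \<noteq> v \<and> card (N x2) = 2)"

definition long3 :: "'a \<Rightarrow> 'a \<Rightarrow> bool" where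
  "long3 v x \<longleftrightarrow> (\<exists>x2 x3. N x = {v, x2} \<and> x2 \<noteq> v \<and> N x2 = {x, x3} \<and> x3 \<noteq> x \<and> card (N x3) = 2)"

lemma long3_imp_long2: "long3 v x \<Longrightarrow> long2 v x"
  unfolding long2_def long3_def by (metis card_2_iff)

text \<open>Each disjunct of \<open>thread\<close> contributes at most one pair, because a walk
  continues through a 2-vertex in only one way. The second disjunct needs \<open>long2 v x\<close>,
  the third \<open>long3 v x\<close>.\<close>

lemma card_thread:
  assumes v: "v \<in> X" and x: "x \<in> N v"
  shows "finite (thread v x)" "card (thread v x) \<le> 1 + of_bool (long2 v x) + of_bool (long3 v x)"
proof -
  have xX: "x \<in> X" using x N_in by blast
  have vx: "v \<in> N x" using N_sym v x by blast
  have bound: "finite (thread v x) \<and> card (thread v x) \<le> length l" if "thread v x \<subseteq> set l" for l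
    using that by (meson List.finite_set card_length card_mono finite_subset le_trans)
  consider (short) "card (N x) \<noteq> 2" | (one) x2 where "N x = {v, x2}" "x2 \<noteq> v" "card (N x2) \<noteq> 2"
    | (more) x2 where "N x = {v, x2}" "x2 \<noteq> v" "card (N x2) = 2"
    using N_other[OF _ vx] by blast
  then have "finite (thread v x) \<and> card (thread v x) \<le> 1 + of_bool (long2 v x) + of_bool (long3 v x)"
  proof cases
    case short
    then have "thread v x \<subseteq> set []" unfolding thread_def by auto
    from bound[OF this] show ?thesis by simp
  next
    case one
    then have "thread v x \<subseteq> set [(x, v)]" unfolding thread_def by auto
    from bound[OF this] show ?thesis by simp
  next
    case more
    have l2: "long2 v x" unfolding long2_def using more by blast
    have "x2 \<in> N x" using more by auto
    then have "x \<in> N x2" using N_sym xX by blast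
    then obtain x3 where Nx2: "N x2 = {x, x3}" "x3 \<noteq> x" using N_other[OF more(3)] by blast
    show ?thesis
    proof (cases "card (N x3) = 2")
      case True
      then have l3: "long3 v x" unfolding long3_def using more Nx2 by blast
      have "thread v x \<subseteq> set [(x, v), (x2, x), (x3, x2)]"
        using more Nx2 unfolding thread_def by auto
      from bound[OF this] show ?thesis using l2 l3 by simp
    next
      case False
      then have "thread v x \<subseteq> set [(x, v), (x2, x)]"
        using more Nx2 unfolding thread_def by auto
      from bound[OF this] show ?thesis using l2 by simp
    qed
  qed
  then show "finite (thread v x)" "card (thread v x) \<le> 1 + of_bool (long2 v x) + of_bool (long3 v x)"
    by auto
qed

lemma no_long_332:
  assumes v: "v \<in> X" and Nv: "N v = {x, y, z}" and distinct: "x \<noteq> y" "x \<noteq> z" "y \<noteq> z"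
  shows "\<not> (long3 v x \<and> long3 v y \<and> long2 v z)"
proof
  assume a: "long3 v x \<and> long3 v y \<and> long2 v z"
  obtain x2 x3 where x: "N x = {v, x2}" "x2 \<noteq> v" "N x2 = {x, x3}" "x3 \<noteq> x" "card (N x3) = 2"
    using a unfolding long3_def by blast
  obtain y2 y3 where y: "N y = {v, y2}" "y2 \<noteq> v" "N y2 = {y, y3}" "y3 \<noteq> y" "card (N y3) = 2"
    using a unfolding long3_def by blast
  obtain z2 where z: "N z = {v, z2}" "z2 \<noteq> v" "card (N z2) = 2"
    using a unfolding long2_def by blast
  show False using no_332_vertex[OF v Nv distinct x y z] .
qed

definition reach :: "'a \<Rightarrow> ('a \<times> 'a) set" where
  "reach v = (\<Union>x\<in>N v. thread v x)"

text \<open>If two of the threads are \<open>long3\<close>, the remaining one is not even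
  \<open>long2\<close>, giving 3 + 3 + 1. If at most one is \<open>long3\<close>, the bound is 3 + 2
  + 2.\<close>

lemma card_reach:
  assumes v: "v \<in> X" and d: "card (N v) = 3"
  shows "finite (reach v)" "card (reach v) \<le> 7"
proof -
  obtain x y z where Nv: "N v = {x, y, z}" and ne: "x \<noteq> y" "x \<noteq> z" "y \<noteq> z"
    using d by (auto simp: card_3_iff)
  show "finite (reach v)" unfolding reach_def using card_thread(1)[OF v] finite_N by blast
  have "card (reach v) \<le> (\<Sum>u\<in>N v. card (thread v u))"
    unfolding reach_def using finite_N by (rule card_UN_le)
  also have "\<dots> \<le> (\<Sum>u\<in>N v. 1 + of_bool (long2 v u) + of_bool (long3 v u))"
    using card_thread(2)[OF v] by (rule sum_mono)
  also have "\<dots> = 3 + of_bool (long2 v x) + of_bool (long3 v x) + of_bool (long2 v y) + of_bool (long3 v y)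
      + of_bool (long2 v z) + of_bool (long3 v z)"
    using ne by (simp add: Nv)
  also have "\<dots> \<le> 7"
    using no_long_332[OF v, of x y z] no_long_332[OF v, of x z y] no_long_332[OF v, of y z x] ne Nv
      long3_imp_long2[of v x] long3_imp_long2[of v y] long3_imp_long2[of v z]
    by (cases "long3 v x"; cases "long3 v y"; cases "long3 v z"; cases "long2 v x"; cases "long2 v y"; cases "long2 v z")
      (simp_all add: insert_commute)
  finally show "card (reach v) \<le> 7" .
qed

text \<open>Walking from \<open>w\<close> through \<open>p\<close>, a 3-vertex is met after at most
  three steps, since otherwise \<open>no_four_thread\<close> applies. Taking both neighbours
  \<open>p\<close> of \<open>w\<close> finds each 2-vertex from both ends of its thread.\<close>

lemma reach_cover:
  assumes w: "w \<in> X" "card (N w) = 2" and p: "p \<in> N w"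
  shows "\<exists>v\<in>X. card (N v) = 3 \<and> (w, p) \<in> reach v"
proof -
  have deg: "card (N u) = 2 \<or> card (N u) = 3" if "u \<in> X" for u
    using deg_ge_2[OF that] deg_le_3[OF that] by linarith
  have pX: "p \<in> X" "w \<in> N p" using p N_in N_sym w by blast+
  show ?thesis
  proof (cases "card (N p) = 3")
    case True
    then show ?thesis using w pX unfolding reach_def thread_def by blast
  next
    case False
    then have p2: "card (N p) = 2" using deg pX by blast
    then obtain q where q: "N p = {w, q}" "q \<noteq> w" using N_other pX by blast
    have "q \<in> N p" using q by auto
    then have qX: "q \<in> X" "p \<in> N q" using N_in N_sym pX by blast+
    show ?thesis
    proof (cases "card (N q) = 3")
      case True
      then have "(w, p) \<in> thread q p" using w p2 q unfolding thread_def by auto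
      then show ?thesis using qX True unfolding reach_def by blast
    next
      case False
      then have q2: "card (N q) = 2" using deg qX by blast
      then obtain r where r: "N q = {p, r}" "r \<noteq> p" using N_other qX by blast
      have "r \<in> N q" using r by auto
      then have rX: "r \<in> X" "q \<in> N r" using N_in N_sym qX by blast+
      have "card (N r) \<noteq> 2" using no_four_thread[OF pX(1) qX(1) q(1) r(1)] q(2) r(2) w(2) by auto
      then have r3: "card (N r) = 3" using deg rX by blast
      have "(w, p) \<in> thread r q" using w p2 q2 q r unfolding thread_def by auto
      then show ?thesis using rX r3 unfolding reach_def by blast
    qed
  qed
qed

text \<open>Counting pairs of a 2-vertex and a neighbour gives \<open>2 * card X2\<close> on one
  side and at most 7 per 3-vertex on the other. The inequality
  \<open>2 * card X2 \<le> 7 * card X3\<close> is the claim after substituting the degrees.\<close>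

lemma dense: "20 * card X \<le> 9 * (\<Sum>v\<in>X. card (N v))"
proof -
  define X2 where "X2 = {v \<in> X. card (N v) = 2}"
  define X3 where "X3 = {v \<in> X. card (N v) = 3}"
  have X: "X = X2 \<union> X3" "X2 \<inter> X3 = {}"
    using deg_ge_2 deg_le_3 unfolding X2_def X3_def by force+
  have fin23: "finite X2" "finite X3" using fin unfolding X2_def X3_def by auto
  have "2 * card X2 = card (SIGMA w:X2. N w)"
    using fin23 finite_N by (simp add: X2_def)
  also have "\<dots> \<le> card (\<Union>v\<in>X3. reach v)"
  proof (rule card_mono)
    show "finite (\<Union>v\<in>X3. reach v)" using fin23 card_reach(1) unfolding X3_def by blast
    show "(SIGMA w:X2. N w) \<subseteq> (\<Union>v\<in>X3. reach v)"
      using reach_cover unfolding X2_def X3_def by blast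
  qed
  also have "\<dots> \<le> (\<Sum>v\<in>X3. card (reach v))" using fin23(2) by (rule card_UN_le)
  also have "\<dots> \<le> (\<Sum>v\<in>X3. 7)" using card_reach(2) unfolding X3_def by (intro sum_mono) auto
  finally have "2 * card X2 \<le> 7 * card X3" by simp
  moreover have "card X = card X2 + card X3"
    using X fin23 card_Un_disjoint by metis
  moreover have "(\<Sum>v\<in>X. card (N v)) = 2 * card X2 + 3 * card X3"
  proof -
    have "(\<Sum>v\<in>X. card (N v)) = (\<Sum>v\<in>X2. card (N v)) + (\<Sum>v\<in>X3. card (N v))"
      using X fin23 sum.union_disjoint by metis
    then show ?thesis by (simp add: X2_def X3_def)
  qed
  ultimately show ?thesis by linarith
qed

end

section \<open>Sparse graphs have balanced colourings\<close>

text \<open>The sparsity assumption concerns all nonempty subsets and is therefore inherited by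
  subsets, which allows induction on the vertex set. A set without a balanced colouring would be
  \<open>critical\<close>, and \<open>dense\<close> then contradicts sparsity of the set
  itself.\<close>

lemma exists_balanced:
  assumes sym: "\<And>u v. R u v \<Longrightarrow> R v u" and irrefl: "\<And>u. \<not> R u u" and "finite X"
    and "\<And>v. v \<in> X \<Longrightarrow> card (nbs R X v) \<le> 3"
    and "\<And>Y. Y \<subseteq> X \<Longrightarrow> Y \<noteq> {} \<Longrightarrow> 9 * (\<Sum>v\<in>Y. card (nbs R Y v)) < 20 * card Y"
  shows "\<exists>m. balanced R X m"
  using assms(3-)
proof (induction X rule: finite_psubset_induct)
  case (psubset X)
  show ?case
  proof (rule ccontr)
    assume none: "\<not> ?case"
    interpret critical R X
    proof
      fix Y assume Y: "Y \<subset> X"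
      have "card (nbs R Y v) \<le> 3" if "v \<in> Y" for v
      proof -
        have "card (nbs R Y v) \<le> card (nbs R X v)"
          using Y psubset.hyps by (intro card_mono) (auto simp: nbs_def)
        then show ?thesis using psubset.prems(1)[of v] that Y by auto
      qed
      then show "\<exists>m. balanced R Y m"
        using psubset.IH[OF Y] psubset.prems(2) Y by (meson psubset_imp_subset subset_trans)
    qed (use sym irrefl psubset.hyps psubset.prems none in auto)
    have "X \<noteq> {}" using not_balanced unfolding balanced_def by auto
    then show False using dense psubset.prems(2)[of X] by auto
  qed
qed

section \<open>Two-colouring the edges of a bipartite graph of maximum degree 2\<close>

definition two_coloring :: "'a set set \<Rightarrow> ('a set \<Rightarrow> bool) \<Rightarrow> bool" where
  "two_coloring W f \<longleftrightarrow> (\<forall>e\<in>W. \<forall>e'\<in>W. e \<noteq> e' \<longrightarrow> e \<inter> e' \<noteq> {} \<longrightarrow> f e \<noteq> f e')"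

lemma two_coloring_insert:
  assumes "two_coloring W f" and "\<And>g. g \<in> W \<Longrightarrow> g \<inter> e \<noteq> {} \<Longrightarrow> f g \<noteq> c" and "e \<notin> W"
  shows "two_coloring (insert e W) (f(e := c))"
  unfolding two_coloring_def
proof (intro ballI impI)
  fix g g' assume g: "g \<in> insert e W" "g' \<in> insert e W" "g \<noteq> g'" "g \<inter> g' \<noteq> {}"
  show "(f(e := c)) g \<noteq> (f(e := c)) g'"
  proof (cases "g = e \<or> g' = e")
    case True
    then show ?thesis using g assms(2)[of g] assms(2)[of g'] by (auto simp: Int_commute)
  next
    case False
    then show ?thesis using g assms(1) unfolding two_coloring_def by simp
  qed
qed

text \<open>Exchanging the colours on the Kempe chain from \<open>u\<close> frees \<open>b\<close>
  at \<open>u\<close>. The chain starts with colour \<open>b\<close>; since \<open>u\<close> and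
  \<open>w\<close> lie on different sides, it could reach \<open>w\<close> only after an odd number
  of edges, hence by an edge of colour \<open>b\<close>, and \<open>w\<close> has none.\<close>

lemma kempe_swap:
  fixes m :: "'a \<Rightarrow> bool"
  assumes col: "two_coloring W f" and bip: "\<And>p q. {p, q} \<in> W \<Longrightarrow> m p \<noteq> m q"
    and edge: "\<And>e. e \<in> W \<Longrightarrow> \<exists>p q. e = {p, q}"
    and u: "\<And>g. g \<in> W \<Longrightarrow> u \<in> g \<Longrightarrow> f g = b"
    and w: "\<And>g. g \<in> W \<Longrightarrow> w \<in> g \<Longrightarrow> f g \<noteq> b" and uw: "m u \<noteq> m w"
  shows "\<exists>f'. two_coloring W f' \<and> (\<forall>g\<in>W. u \<in> g \<or> w \<in> g \<longrightarrow> f' g \<noteq> b)"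
proof -
  \<comment> \<open>Steps leaving the side of \<open>u\<close> have colour \<open>b\<close>, steps
    leaving the other side have the opposite colour, so walks from \<open>u\<close> along
    \<open>S\<close> alternate in colour.\<close>
  define S where "S = {(p, q). {p, q} \<in> W \<and> f {p, q} = (b = (m p = m u))}"
  \<comment> \<open>Orienting the Kempe chain that starts at \<open>u\<close> makes it clear that bipartiteness keeps it away from \<open>w\<close>.\<close>
  define P where "P = S\<^sup>* `` {u}"
  have uP: "u \<in> P" unfolding P_def by auto
  have step: "q \<in> P" if "p \<in> P" "(p, q) \<in> S" for p q
    using that unfolding P_def by (auto intro: rtrancl.rtrancl_into_rtrancl)
  have pred: "q = u \<or> (\<exists>p\<in>P. (p, q) \<in> S)" if "q \<in> P" for q
    using that unfolding P_def by (auto elim: rtranclE)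
  have wP: "w \<notin> P"
  proof
    assume "w \<in> P"
    then obtain p where p: "{p, w} \<in> W" "f {p, w} = (b = (m p = m u))"
      using pred uw unfolding S_def by blast
    then have "m p = m u" using bip[of p w] uw by auto
    then show False using p w[of "{p, w}"] by auto
  qed
  \<comment> \<open>\<open>P\<close> is closed under all edges of \<open>W\<close>. An edge at
    \<open>p\<close> outside \<open>S\<close> has the colour of the edge by which \<open>p\<close>
    was entered, so by properness it is that edge and leads back into \<open>P\<close>.\<close>
  have closed: "q \<in> P" if g: "{p, q} \<in> W" and p: "p \<in> P" for p q
  proof (rule ccontr)
    assume q: "q \<notin> P"
    then have nS: "(p, q) \<notin> S" using step p by blast
    have "p \<noteq> u" using u[of "{p, q}"] g nS unfolding S_def by auto
    then obtain r where r: "r \<in> P" "{r, p} \<in> W" "f {r, p} = (b = (m r = m u))"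
      using pred[OF p] unfolding S_def by blast
    have "f {p, q} \<noteq> (b = (m p = m u))" using nS g unfolding S_def by auto
    then have "f {p, q} = f {r, p}" using r bip[of r p] by auto
    moreover have "{p, q} \<inter> {r, p} \<noteq> {}" by auto
    ultimately have "{p, q} = {r, p}"
      using col[unfolded two_coloring_def, rule_format, OF g r(2)] by blast
    then show False using r(1) q p by (auto simp: doubleton_eq_iff)
  qed
  have sub: "g \<subseteq> P" if g: "g \<in> W" "g \<inter> P \<noteq> {}" for g
  proof -
    obtain p q where "g = {p, q}" using edge g(1) by blast
    then show ?thesis using g closed[of p q] closed[of q p] by (auto simp: insert_commute)
  qed
  define f' where "f' g = (if g \<inter> P \<noteq> {} then \<not> f g else f g)" for g
  have "two_coloring W f'"
    unfolding two_coloring_def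
  proof (intro ballI impI)
    fix e e' assume e: "e \<in> W" "e' \<in> W" "e \<noteq> e'" "e \<inter> e' \<noteq> {}"
    then have "e \<inter> P \<noteq> {} \<longleftrightarrow> e' \<inter> P \<noteq> {}" using sub[of e] sub[of e'] by blast
    moreover have "f e \<noteq> f e'" using e col unfolding two_coloring_def by blast
    ultimately show "f' e \<noteq> f' e'" unfolding f'_def by auto
  qed
  moreover have "f' g \<noteq> b" if "g \<in> W" "u \<in> g" for g
    using u[OF that] that uP unfolding f'_def by auto
  moreover have "f' g \<noteq> b" if "g \<in> W" "w \<in> g" for g
    using w[OF that] that sub[of g] wP unfolding f'_def by auto
  ultimately show ?thesis by blast
qed

text \<open>The case of maximum degree 2 of Koenig's edge-colouring theorem, adding one edge at a
  time. Each end of the new edge meets at most one old edge; if no colour is free at both ends,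
  \<open>kempe_swap\<close> makes one free.\<close>

lemma bipartite_two_coloring:
  fixes m :: "'a \<Rightarrow> bool"
  assumes "finite W" and "\<And>e. e \<in> W \<Longrightarrow> \<exists>p q. e = {p, q} \<and> m p \<noteq> m q"
    and "\<And>v. card {e \<in> W. v \<in> e} \<le> 2"
  shows "\<exists>f. two_coloring W f"
  using assms
proof (induction W)
  case empty
  then show ?case unfolding two_coloring_def by auto
next
  case (insert e W)
  have bip: "m p \<noteq> m q" if "{p, q} \<in> insert e W" for p q
    using insert.prems(1)[OF that] by (auto simp: doubleton_eq_iff)
  have "card {g \<in> W. v \<in> g} \<le> 2" for v
  proof -
    have "card {g \<in> W. v \<in> g} \<le> card {g \<in> insert e W. v \<in> g}"
      using insert.hyps by (intro card_mono) auto
    then show ?thesis using insert.prems(2)[of v] by linarith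
  qed
  then obtain f where f: "two_coloring W f" using insert.IH insert.prems(1) by blast
  obtain u w where e: "e = {u, w}" "m u \<noteq> m w" using insert.prems(1) by blast
  have single: "g = g'" if "v \<in> e" "g \<in> W" "v \<in> g" "g' \<in> W" "v \<in> g'" for v g g'
  proof -
    have "{g \<in> insert e W. v \<in> g} = insert e {g \<in> W. v \<in> g}" using that by auto
    then have "card {g \<in> W. v \<in> g} \<le> 1" using insert.prems(2)[of v] insert.hyps by simp
    moreover have "finite {g \<in> W. v \<in> g}" using insert.hyps by simp
    ultimately show ?thesis using that by (simp add: card_le_Suc0_iff_eq)
  qed
  have "\<exists>f c. two_coloring W f \<and> (\<forall>g\<in>W. u \<in> g \<or> w \<in> g \<longrightarrow> f g \<noteq> c)"
  proof (cases "\<exists>c. \<forall>g\<in>W. u \<in> g \<or> w \<in> g \<longrightarrow> f g \<noteq> c")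
    case True
    then show ?thesis using f by blast
  next
    case False
    then obtain gt gf where g: "gt \<in> W" "u \<in> gt \<or> w \<in> gt" "f gt" "gf \<in> W" "u \<in> gf \<or> w \<in> gf" "\<not> f gf"
      by (metis (full_types))
    have uw: "u \<in> e" "w \<in> e" using e by auto
    \<comment> \<open>Both colours occur at the ends of \<open>e\<close>, and each end meets at most
      one old edge, so \<open>gt\<close> and \<open>gf\<close> sit at different ends;
      \<open>b\<close> is the colour at \<open>u\<close>.\<close>
    have "\<exists>b. (\<forall>g\<in>W. u \<in> g \<longrightarrow> f g = b) \<and> (\<forall>g\<in>W. w \<in> g \<longrightarrow> f g \<noteq> b)"
    proof (cases "u \<in> gt")
      case True
      then have "u \<notin> gf" using single[OF uw(1) g(1) True g(4)] g by blast
      then have "w \<in> gf" using g by blast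
      then have "(\<forall>g\<in>W. u \<in> g \<longrightarrow> g = gt) \<and> (\<forall>g\<in>W. w \<in> g \<longrightarrow> g = gf)"
        using single[OF uw(1) _ _ g(1) True] single[OF uw(2) _ _ g(4)] by blast
      then show ?thesis using g by (intro exI[of _ True]) blast
    next
      case False
      then have wgt: "w \<in> gt" using g by blast
      then have "w \<notin> gf" using single[OF uw(2) g(1) wgt g(4)] g by blast
      then have "u \<in> gf" using g by blast
      then have "(\<forall>g\<in>W. u \<in> g \<longrightarrow> g = gf) \<and> (\<forall>g\<in>W. w \<in> g \<longrightarrow> g = gt)"
        using single[OF uw(2) _ _ g(1) wgt] single[OF uw(1) _ _ g(4)] by blast
      then show ?thesis using g by (intro exI[of _ False]) blast
    qed
    then obtain b where "\<forall>g\<in>W. u \<in> g \<longrightarrow> f g = b" "\<forall>g\<in>W. w \<in> g \<longrightarrow> f g \<noteq> b" by blast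
    moreover have "\<exists>p q. g = {p, q}" if "g \<in> W" for g using insert.prems(1)[of g] that by blast
    moreover have "m p \<noteq> m q" if "{p, q} \<in> W" for p q using bip that by blast
    ultimately have "\<exists>f'. two_coloring W f' \<and> (\<forall>g\<in>W. u \<in> g \<or> w \<in> g \<longrightarrow> f' g \<noteq> b)"
      using e(2) by (intro kempe_swap[OF f, of m u b w]) auto
    then show ?thesis by blast
  qed
  then obtain f c where "two_coloring W f" "\<forall>g\<in>W. u \<in> g \<or> w \<in> g \<longrightarrow> f g \<noteq> c" by blast
  then have "two_coloring (insert e W) (f(e := c))"
    using two_coloring_insert[of W f e c] insert.hyps e by blast
  then show ?case by blast
qed

section \<open>Distance conditions in terms of intersecting edges\<close>

lemma dist_packing_2I:
  assumes "M \<subseteq> E" and "\<And>e f. e \<in> M \<Longrightarrow> f \<in> M \<Longrightarrow> e \<noteq> f \<Longrightarrow> e \<inter> f = {}"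
  shows "dist_packing E 2 M"
  unfolding dist_packing_def edge_dist_ge_def
proof (intro conjI ballI impI notI)
  fix e f assume ef: "e \<in> M" "f \<in> M" "e \<noteq> f" and "\<exists>n<2. edge_walk E e f n"
  then obtain n ps where n: "n < 2" and ps: "length ps = Suc n" "hd ps = e" "last ps = f"
      "\<forall>i<n. line_adj (ps ! i) (ps ! Suc i)"
    unfolding edge_walk_def by auto
  then consider "n = 0" | "n = 1" by linarith
  then show False
  proof cases
    case 1
    then show ?thesis using ps ef by (auto simp: length_Suc_conv)
  next
    case 2
    then have "line_adj e f" using ps by (auto simp: length_Suc_conv)
    then show ?thesis using assms(2) ef unfolding line_adj_def by blast
  qed
qed (rule assms)

text \<open>Besides the walks excluded for distance 2, only walks \<open>[e, g, f]\<close> remain,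
  and \<open>line_adj\<close> makes \<open>g\<close> different from both ends.\<close>

lemma dist_packing_3I:
  assumes "M \<subseteq> E" and "\<And>e f. e \<in> M \<Longrightarrow> f \<in> M \<Longrightarrow> e \<noteq> f \<Longrightarrow> e \<inter> f = {}"
    and "\<And>e f g. e \<in> M \<Longrightarrow> f \<in> M \<Longrightarrow> e \<noteq> f \<Longrightarrow> g \<in> E \<Longrightarrow> g \<noteq> e \<Longrightarrow> g \<noteq> f \<Longrightarrow> e \<inter> g = {} \<or> g \<inter> f = {}"
  shows "dist_packing E 3 M"
  unfolding dist_packing_def edge_dist_ge_def
proof (intro conjI ballI impI notI)
  fix e f assume ef: "e \<in> M" "f \<in> M" "e \<noteq> f" and "\<exists>n<3. edge_walk E e f n"
  then obtain n ps where n: "n < 3" and ps: "length ps = Suc n" "hd ps = e" "last ps = f" "set ps \<subseteq> E"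
      "\<forall>i<n. line_adj (ps ! i) (ps ! Suc i)"
    unfolding edge_walk_def by auto
  then consider "n = 0" | "n = 1" | "n = 2" by linarith
  then show False
  proof cases
    case 1
    then show ?thesis using ps ef by (auto simp: length_Suc_conv)
  next
    case 2
    then have "line_adj e f" using ps by (auto simp: length_Suc_conv)
    then show ?thesis using assms(2) ef unfolding line_adj_def by blast
  next
    case 3
    then obtain g where g: "ps = [e, g, f]" using ps by (auto simp: length_Suc_conv numeral_2_eq_2)
    then have "line_adj e g" "line_adj g f" "g \<in> E"
      using ps(4) ps(5)[rule_format, of 0] ps(5)[rule_format, of 1] 3 by auto
    then show ?thesis using assms(3)[OF ef] unfolding line_adj_def by blast
  qed
qed (rule assms)

section \<open>From maximum average degree to degree sums\<close>

lemma graph_edge: "graph V E \<Longrightarrow> e \<in> E \<Longrightarrow> \<exists>u v. e = {u, v} \<and> u \<noteq> v \<and> u \<in> V \<and> v \<in> V"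
  unfolding graph_def by blast

text \<open>Phrased for the subgraph induced by \<open>Y\<close>, so that it serves the handshake
  count on any \<open>Y\<close> and, with \<open>Y\<close> the whole vertex set, also
  \<open>degree\<close>.\<close>

lemma card_nbs_eq_incident:
  assumes G: "graph V E" and v: "v \<in> Y"
  shows "card (nbs (\<lambda>u w. {u, w} \<in> E) Y v) = card {e \<in> {e \<in> E. e \<subseteq> Y}. v \<in> e}"
proof (rule bij_betw_same_card)
  show "bij_betw (\<lambda>w. {v, w}) (nbs (\<lambda>u w. {u, w} \<in> E) Y v) {e \<in> {e \<in> E. e \<subseteq> Y}. v \<in> e}"
    unfolding bij_betw_def
  proof
    show "inj_on (\<lambda>w. {v, w}) (nbs (\<lambda>u w. {u, w} \<in> E) Y v)"
      by (auto simp: inj_on_def doubleton_eq_iff)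
    show "(\<lambda>w. {v, w}) ` nbs (\<lambda>u w. {u, w} \<in> E) Y v = {e \<in> {e \<in> E. e \<subseteq> Y}. v \<in> e}"
    proof
      show "(\<lambda>w. {v, w}) ` nbs (\<lambda>u w. {u, w} \<in> E) Y v \<subseteq> {e \<in> {e \<in> E. e \<subseteq> Y}. v \<in> e}"
        using v by (auto simp: nbs_def)
      show "{e \<in> {e \<in> E. e \<subseteq> Y}. v \<in> e} \<subseteq> (\<lambda>w. {v, w}) ` nbs (\<lambda>u w. {u, w} \<in> E) Y v"
      proof
        fix e assume e: "e \<in> {e \<in> {e \<in> E. e \<subseteq> Y}. v \<in> e}"
        then obtain p q where "e = {p, q}" using graph_edge[OF G, of e] e by blast
        then obtain w where "e = {v, w}" using e by auto
        then show "e \<in> (\<lambda>w. {v, w}) ` nbs (\<lambda>u w. {u, w} \<in> E) Y v" using e by (auto simp: nbs_def)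
      qed
    qed
  qed
qed

lemma finite_edges: "graph V E \<Longrightarrow> finite E"
  by (rule finite_subset[of E "Pow V"]) (auto simp: graph_def)

text \<open>The subgraph induced by \<open>Y\<close> is one of the competitors in the maximum, and
  the handshake identity turns its edge count into a degree sum.\<close>

lemma mad_bound:
  assumes G: "graph V E" and mad: "mad V E < 20 / 9" and Y: "Y \<subseteq> V" "Y \<noteq> {}"
  shows "9 * (\<Sum>v\<in>Y. card (nbs (\<lambda>u w. {u, w} \<in> E) Y v)) < 20 * card Y"
proof -
  let ?F = "{e \<in> E. e \<subseteq> Y}"
  have fin: "finite V" "finite E" using G finite_edges[OF G] unfolding graph_def by auto
  then have finY: "finite Y" using Y finite_subset by blast
  have "(\<Sum>v\<in>Y. card (nbs (\<lambda>u w. {u, w} \<in> E) Y v)) = (\<Sum>v\<in>Y. card {e \<in> ?F. v \<in> e})"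
    by (rule sum.cong) (simp_all only: card_nbs_eq_incident[OF G])
  also have "\<dots> = 2 * card ?F"
  proof (rule sum_multicount)
    show "\<forall>e\<in>?F. card {v \<in> Y. v \<in> e} = 2"
    proof
      fix e assume e: "e \<in> ?F"
      then obtain u v where uv: "e = {u, v}" "u \<noteq> v" using graph_edge[OF G, of e] by blast
      have "{v \<in> Y. v \<in> e} = e" using e by auto
      then show "card {v \<in> Y. v \<in> e} = 2" using uv by simp
    qed
  qed (use fin finY in auto)
  finally have sum: "(\<Sum>v\<in>Y. card (nbs (\<lambda>u w. {u, w} \<in> E) Y v)) = 2 * card ?F" .
  have "graph Y ?F" unfolding graph_def using finY graph_edge[OF G] by fastforce
  then have sub: "subgraph Y ?F V E" unfolding subgraph_def using Y by auto
  let ?A = "{2 * real (card E') / real (card V') | V' E'. subgraph V' E' V E \<and> V' \<noteq> {}}"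
  \<comment> \<open>\<open>Max\<close> is an upper bound only for a finite set, so the set of ratios
    has to be shown finite first.\<close>
  have "?A \<subseteq> (\<lambda>(V', E'). 2 * real (card E') / real (card V')) ` (Pow V \<times> Pow E)"
    unfolding subgraph_def by auto
  then have "finite ?A" using fin by (meson finite_Pow_iff finite_SigmaI finite_imageI finite_subset)
  moreover have "2 * real (card ?F) / real (card Y) \<in> ?A" using sub Y by blast
  ultimately have "2 * real (card ?F) / real (card Y) \<le> mad V E"
    unfolding mad_def by (rule Max_ge)
  then have "2 * real (card ?F) / real (card Y) < 20 / 9" using mad by simp
  moreover have "card Y > 0" using finY Y by (simp add: card_gt_0_iff)
  ultimately have "9 * (2 * real (card ?F)) < 20 * real (card Y)" by (simp add: field_simps)
  then show ?thesis unfolding sum by linarith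
qed

section \<open>From a balanced colouring to the packing\<close>

lemma packing_if_balanced:
  assumes G: "graph V E" and bal: "balanced (\<lambda>u w. {u, w} \<in> E) V m"
  shows "packing_1122 E"
proof -
  let ?N = "nbs (\<lambda>u w. {u, w} \<in> E) V"
  have finV: "finite V" using G unfolding graph_def by blast
  have finN: "finite (?N v)" for v using finV unfolding nbs_def by simp
  have inV: "p \<in> V" "q \<in> V" "p \<noteq> q" if "{p, q} \<in> E" for p q
    using graph_edge[OF G that] by (auto simp: doubleton_eq_iff)
  \<comment> \<open>Having at most one neighbour of the same colour makes the monochromatic edges a
    matching.\<close>
  have same: "q = r" if "{p, q} \<in> E" "{p, r} \<in> E" "m q = m p" "m r = m p" for p q r
  proof -
    have "card {w \<in> ?N p. m w = m p} \<le> 1"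
      using bal inV(1)[OF that(1)] unfolding balanced_def balanced_at_def by blast
    moreover have "finite {w \<in> ?N p. m w = m p}" using finN by simp
    moreover have "q \<in> {w \<in> ?N p. m w = m p}" "r \<in> {w \<in> ?N p. m w = m p}"
      using that inV unfolding nbs_def by auto
    ultimately show ?thesis by (simp add: card_le_Suc0_iff_eq)
  qed
  define S where "S c = {e \<in> E. \<forall>v\<in>e. m v = c}" for c
  define W where "W = E - (S True \<union> S False)"
  have W: "\<exists>p q. e = {p, q} \<and> m p \<noteq> m q" if e: "e \<in> W" for e
  proof -
    obtain p q where "e = {p, q}" using graph_edge[OF G, of e] e unfolding W_def by blast
    then show ?thesis using e unfolding W_def S_def by auto
  qed
  have "card {e \<in> W. v \<in> e} \<le> 2" for v
  proof (cases "v \<in> V")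
    case True
    have "{e \<in> W. v \<in> e} \<subseteq> (\<lambda>w. {v, w}) ` {w \<in> ?N v. m w \<noteq> m v}"
    proof
      fix e assume e: "e \<in> {e \<in> W. v \<in> e}"
      then obtain p q where "e = {p, q}" "m p \<noteq> m q" using W by blast
      then obtain w where w: "e = {v, w}" "m w \<noteq> m v" using e by auto
      then have "w \<in> ?N v" using e inV[of v w] unfolding W_def nbs_def by auto
      then show "e \<in> (\<lambda>w. {v, w}) ` {w \<in> ?N v. m w \<noteq> m v}" using w by blast
    qed
    then have "card {e \<in> W. v \<in> e} \<le> card {w \<in> ?N v. m w \<noteq> m v}"
      using finN by (intro surj_card_le) auto
    then show ?thesis using bal True unfolding balanced_def balanced_at_def by fastforce
  next
    case False
    then have "{e \<in> W. v \<in> e} = {}" using graph_edge[OF G] unfolding W_def by blast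
    then show ?thesis by (simp only: card.empty)
  qed
  moreover have "finite W" using finite_edges[OF G] unfolding W_def by simp
  ultimately obtain f where f: "two_coloring W f" using bipartite_two_coloring[of W m] W by blast
  define M where "M c = {e \<in> W. f e = c}" for c
  have M: "dist_packing E 2 (M c)" for c
    by (rule dist_packing_2I) (use f in \<open>auto simp: M_def W_def two_coloring_def\<close>)
  have S: "dist_packing E 3 (S c)" for c
  proof (rule dist_packing_3I)
    show "S c \<subseteq> E" unfolding S_def by auto
    have edge: "\<exists>q. e = {p, q} \<and> m q = m p \<and> {p, q} \<in> E" if "e \<in> S c" "p \<in> e" for e p
      using graph_edge[OF G, of e] that unfolding S_def by (auto simp: insert_commute)
    show disj: "e \<inter> f = {}" if ef: "e \<in> S c" "f \<in> S c" "e \<noteq> f" for e f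
    proof (rule ccontr)
      assume "e \<inter> f \<noteq> {}"
      then obtain p where p: "p \<in> e" "p \<in> f" by blast
      obtain q where q: "e = {p, q}" "m q = m p" "{p, q} \<in> E" using edge[OF ef(1) p(1)] by blast
      obtain r where r: "f = {p, r}" "m r = m p" "{p, r} \<in> E" using edge[OF ef(2) p(2)] by blast
      show False using same[OF q(3) r(3) q(2) r(2)] q(1) r(1) ef(3) by blast
    qed
    show "e \<inter> g = {} \<or> g \<inter> f = {}"
      if ef: "e \<in> S c" "f \<in> S c" "e \<noteq> f" and gE: "g \<in> E" and "g \<noteq> e" "g \<noteq> f" for e f g
    proof (rule ccontr)
      assume "\<not> (e \<inter> g = {} \<or> g \<inter> f = {})"
      then obtain p q where p: "p \<in> e" "p \<in> g" and q: "q \<in> g" "q \<in> f" by blast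
      have "p \<noteq> q" using disj[OF ef] p q by blast
      moreover obtain a b where "g = {a, b}" using graph_edge[OF G gE] by blast
      ultimately have g: "g = {p, q}" using p q by auto
      \<comment> \<open>An edge joining two edges of \<open>S c\<close> has both ends of colour
        \<open>c\<close>, so it belongs to \<open>S c\<close> itself while meeting \<open>e\<close>,
        contrary to disjointness.\<close>
      have "m p = c" "m q = c" using p q ef unfolding S_def by auto
      then have "g \<in> S c" using g gE unfolding S_def by auto
      then show False using disj[of e g] that p by blast
    qed
  qed
  have cover: "M True \<union> M False \<union> S True \<union> S False = E"
    unfolding M_def W_def S_def by auto
  have MM: "M True \<inter> M False = {}" unfolding M_def by auto
  have MS: "M c \<inter> S c' = {}" for c c' unfolding M_def W_def by (cases c') auto
  \<comment> \<open>An empty edge would belong to both sets vacuously, so disjointness rests on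
    edges being nonempty.\<close>
  have SS: "S True \<inter> S False = {}"
  proof -
    have "e \<noteq> {}" if "e \<in> E" for e using graph_edge[OF G that] by blast
    then show ?thesis unfolding S_def by blast
  qed
  show ?thesis
    unfolding packing_1122_def
    by (rule exI[of _ "M True"], rule exI[of _ "M False"], rule exI[of _ "S True"], rule exI[of _ "S False"],
        intro conjI cover MM MS SS M S)
qed

theorem theorem2:
  fixes V :: "'a set" and E :: "'a set set"
  assumes "graph V E" and "subcubic V E" and "mad V E < 20 / 9"
  shows "packing_1122 E"
proof -
  let ?R = "\<lambda>u w. {u, w} \<in> E"
  have "\<exists>m. balanced ?R V m"
  proof (rule exists_balanced)
    show "?R v u" if "?R u v" for u v using that by (simp add: insert_commute)
    show "\<not> ?R u u" for u
    proof
      assume "{u, u} \<in> E"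
      then show False using graph_edge[OF assms(1), of "{u, u}"] by (auto simp: doubleton_eq_iff)
    qed
    show "finite V" using assms(1) unfolding graph_def by blast
    show "card (nbs ?R V v) \<le> 3" if "v \<in> V" for v
    proof -
      have "{e \<in> {e \<in> E. e \<subseteq> V}. v \<in> e} = {e \<in> E. v \<in> e}"
        using graph_edge[OF assms(1)] by blast
      then show ?thesis
        using card_nbs_eq_incident[OF assms(1) that] assms(2) that
        unfolding subcubic_def degree_def by simp
    qed
    show "9 * (\<Sum>v\<in>Y. card (nbs ?R Y v)) < 20 * card Y" if "Y \<subseteq> V" "Y \<noteq> {}" for Y
      using mad_bound[OF assms(1) assms(3) that] .
  qed
  then show ?thesis using packing_if_balanced[OF assms(1)] by blast
qed

end
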